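(* Let $s,r\in\mathbb N_+$ and let $(A,b)$, $A=(a_{ij})_{i,j=1}^s$, $b=(b_i)_{i=1}^s$, and $(\tilde A,\tilde b)$, $\tilde A=(\tilde a_{mn})_{m,n=1}^r$, $\tilde b=(\tilde b_m)_{m=1}^r$, be real Runge--Kutta coefficients. Consider the splitting Runge--Kutta method for the nonlinear stochastic wave equation given, for $i=1,\dots,s$ and $m=1,\dots,r$, by \begin{align*} &U_i^m=u_0^m+\Delta x\sum_{j=1}^s a_{ij}\mathcal W_j^m,\qquad \mathcal W_i^m=w_0^m+\Delta x\sum_{j=1}^s a_{ij}\,\delta_x\mathcal W_j^m,\\ &\overline u_1^m=u_0^m+\Delta x\sum_{i=1}^s b_i\mathcal W_i^m,\qquad \overline w_1^m=w_0^m+\Delta x\sum_{i=1}^s b_i\,\delta_x\mathcal W_i^m,\\ &U_i^m=u_i^0+\Delta t\sum_{n=1}^r\tilde a_{mn}V_i^n,\qquad V_i^m=v_i^0+\Delta t\sum_{n=1}^r\tilde a_{mn}\big(\delta_x\mathcal W_i^n-f(U_i^n)\big),\\ &\overline u_i^1=u_i^0+\Delta t\sum_{m=1}^r\tilde b_mV_i^m,\qquad \overline v_i^1=v_i^0+\Delta t\sum_{m=1}^r\tilde b_m\big(\delta_x\mathcal W_i^m-f(U_i^m)\big),\\ &u_1^m=\overline u_1^m,\quad w_1^m=\overline w_1^m,\qquad u_i^1=\overline u_i^1,\quad v_i^1=\overline v_i^1+g(\overline u_i^1)\,\Delta W_i^1 . \end{align*} Assume the symplectic condition $$b_ib_j-b_ia_{ij}-b_ja_{ji}=0\quad(1\le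 i,j\le s),\qquad \tilde b_m\tilde b_n-\tilde b_m\tilde a_{mn}-\tilde b_n\tilde a_{nm}=0\quad(1\le m,n\le r),$$ equivalently $BA+A^\top B-bb^\top=0$ and $\tilde B\tilde A+\tilde A^\top\tilde B-\tilde b\tilde b^\top=0$ with $B=\operatorname{diag}(b)$, $\tilde B=\operatorname{diag}(\tilde b)$. Then the method admits, almost surely, the discrete multi-symplectic conservation law $$\sum_{i=1}^s\frac{b_i}{\Delta t}\big(\mathrm du_i^1\wedge\mathrm dv_i^1-\mathrm du_i^0\wedge\mathrm dv_i^0\big)-\sum_{m=1}^r\frac{\tilde b_m}{\Delta x}\big(\mathrm du_1^m\wedge\mathrm dw_1^m-\mathrm du_0^m\wedge\mathrm dw_0^m\big)=0 .$$
   Context: The stochastic wave equation is $du=v\,dt$, $u_x=w$, $dv-w_x\,dt=-f(u)\,dt+g(u)\circ dW(t)$, where $f=\tilde f'$, $g=\tilde g'$ act pointwise, with $\tilde f,\tilde g$ smooth and $f,g$ globally Lipschitz, and $W$ is an $L^2$-valued $Q$-Wiener process with trace-class $Q$. The method treats one space-time cell $[0,\Delta x]\times[0,\Delta t]$: the deterministic part is discretized by Runge--Kutta methods in space and time, the remaining stochastic part by the symplectic Euler method. All quantities are real numbers for each realization of the noise. Stage quantities $U_i^m,V_i^m,\mathcal W_i^m$ approximate $u,v,w$ at $(c_i\Delta x,\tilde c_m\Delta t)$ with $c_i=\sum_ja_{ij}$, $\tilde c_m=\sum_n\tilde a_{mn}$; $\delta_x\mathcal W_i^m$ is the stage quantity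 discretizing $\partial_xw$ there. Superscripts $0,1$ on $u_i,v_i$ refer to times $0,\Delta t$ at $x=c_i\Delta x$; subscripts $0,1$ on $u^m,w^m$ refer to $x=0,\Delta x$ at time $\tilde c_m\Delta t$ (thus $u_i^1$, indexed by a spatial stage, and $u_1^m$, indexed by a temporal stage, are different families). $\Delta W_i^1=W(c_i\Delta x,\Delta t)-W(c_i\Delta x,0)$. $\mathrm d$ (roman) is the exterior derivative: for a fixed realization of the noise, all numerical quantities are regarded as differentiable functions of parameters (e.g. the data), so their differentials satisfy the linearized scheme and noise increments carry no differential. *)

theory Defs
  imports "HOL-Probability.Probability"
begin

section \<open>The noise\<close>

text \<open>
  Elements of \<open>L\<^sup>2(N)\<close> are represented by functions rather than by almost-everywhere classes,
  because the numerical method evaluates the noise at points of space.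
\<close>

definition l2_space :: "real measure \<Rightarrow> (real \<Rightarrow> real) set" where
  "l2_space N = {h. h \<in> borel_measurable N \<and> integrable N (\<lambda>x. (h x)\<^sup>2)}"

definition l2_inner :: "real measure \<Rightarrow> (real \<Rightarrow> real) \<Rightarrow> (real \<Rightarrow> real) \<Rightarrow> real" where
  "l2_inner N h k = (\<integral>x. h x * k x \<partial>N)"

text \<open>
  The sigma-algebra generated by the functionals \<open>\<langle>\<cdot>, k\<rangle>\<close>; as \<open>L\<^sup>2\<close> over Lebesgue measure is
  separable, this is the Borel sigma-algebra of the \<open>L\<^sup>2\<close> norm.
\<close>

definition l2_borel :: "real measure \<Rightarrow> (real \<Rightarrow> real) measure" where
  "l2_borel N = sigma (l2_space N)
     {{h \<in> l2_space N. l2_inner N h k \<le> a} | k a. k \<in> l2_space N}"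

definition orthonormal_basis :: "real measure \<Rightarrow> (nat \<Rightarrow> real \<Rightarrow> real) \<Rightarrow> bool" where
  "orthonormal_basis N e \<longleftrightarrow>
     (\<forall>k. e k \<in> l2_space N) \<and>
     (\<forall>j k. l2_inner N (e j) (e k) = (if j = k then 1 else 0)) \<and>
     (\<forall>h\<in>l2_space N. (\<forall>k. l2_inner N h (e k) = 0) \<longrightarrow> (AE x in N. h x = 0))"

text \<open>
  A linear, symmetric, nonnegative operator of finite trace.  Symmetry on all of \<open>L\<^sup>2\<close> makes \<open>Q\<close>
  bounded and compatible with equality almost everywhere; for a nonnegative operator the trace
  does not depend on the basis.
\<close>

definition trace_class_covariance ::
    "real measure \<Rightarrow> ((real \<Rightarrow> real) \<Rightarrow> (real \<Rightarrow> real)) \<Rightarrow> bool" where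
  "trace_class_covariance N Q \<longleftrightarrow>
     (\<forall>h\<in>l2_space N. Q h \<in> l2_space N) \<and>
     (\<forall>h\<in>l2_space N. \<forall>k\<in>l2_space N. \<forall>\<alpha> \<beta>.
        AE x in N. Q (\<lambda>y. \<alpha> * h y + \<beta> * k y) x = \<alpha> * Q h x + \<beta> * Q k x) \<and>
     (\<forall>h\<in>l2_space N. \<forall>k\<in>l2_space N. l2_inner N (Q h) k = l2_inner N h (Q k)) \<and>
     (\<forall>h\<in>l2_space N. l2_inner N (Q h) h \<ge> 0) \<and>
     (\<exists>e. orthonormal_basis N e \<and> summable (\<lambda>k. l2_inner N (Q (e k)) (e k)))"

text \<open>The normal law with mean 0 and variance \<open>v\<close>, the point mass at 0 if \<open>v = 0\<close>.\<close>

definition centred_normal :: "'w measure \<Rightarrow> ('w \<Rightarrow> real) \<Rightarrow> real \<Rightarrow> bool" where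
  "centred_normal M X v \<longleftrightarrow>
     (if v = 0 then X \<in> borel_measurable M \<and> (AE \<omega> in M. X \<omega> = 0)
      else v > 0 \<and> distributed M lborel X (\<lambda>x. ennreal (normal_density 0 (sqrt v) x)))"

text \<open>
  \<open>W t \<omega>\<close> is the path at time \<open>t \<ge> 0\<close>.  An \<open>L\<^sup>2\<close>-valued increment has law \<open>N(0, (t - t') Q)\<close> iff
  all its scalar products with \<open>h\<close> are centred normal with variance \<open>(t - t') \<langle>Q h, h\<rangle>\<close>.
\<close>

definition Q_Wiener_process ::
    "'w measure \<Rightarrow> real measure \<Rightarrow> ((real \<Rightarrow> real) \<Rightarrow> (real \<Rightarrow> real)) \<Rightarrow>
     (real \<Rightarrow> 'w \<Rightarrow> real \<Rightarrow> real) \<Rightarrow> bool" where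
  "Q_Wiener_process M N Q W \<longleftrightarrow>
     prob_space M \<and>
     trace_class_covariance N Q \<and>
     (\<forall>t\<ge>0. W t \<in> measurable M (l2_borel N)) \<and>
     (AE \<omega> in M. AE x in N. W 0 \<omega> x = 0) \<and>
     (AE \<omega> in M. \<forall>t\<ge>0.
        ((\<lambda>\<tau>. \<integral>x. (W \<tau> \<omega> x - W t \<omega> x)\<^sup>2 \<partial>N) \<longlongrightarrow> 0) (at t within {0..})) \<and>
     (\<forall>(n::nat) (t :: nat \<Rightarrow> real). t 0 \<ge> 0 \<and> (\<forall>k<n. t k < t (Suc k)) \<longrightarrow>
        prob_space.indep_vars M (\<lambda>_. l2_borel N)
          (\<lambda>k \<omega> x. W (t (Suc k)) \<omega> x - W (t k) \<omega> x) {..<n}) \<and>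
     (\<forall>t' t h. 0 \<le> t' \<and> t' < t \<and> h \<in> l2_space N \<longrightarrow>
        centred_normal M (\<lambda>\<omega>. l2_inner N (\<lambda>x. W t \<omega> x - W t' \<omega> x) h)
          ((t - t') * l2_inner N (Q h) h))"

section \<open>The coefficients\<close>

definition smooth_fun :: "(real \<Rightarrow> real) \<Rightarrow> bool" where
  "smooth_fun h \<longleftrightarrow> (\<forall>n x. (deriv ^^ n) h differentiable (at x))"

definition globally_lipschitz :: "(real \<Rightarrow> real) \<Rightarrow> bool" where
  "globally_lipschitz h \<longleftrightarrow> (\<exists>L. L-lipschitz_on UNIV h)"

definition symplectic_condition :: "nat \<Rightarrow> (nat \<Rightarrow> nat \<Rightarrow> real) \<Rightarrow> (nat \<Rightarrow> real) \<Rightarrow> bool" where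
  "symplectic_condition s A b \<longleftrightarrow>
     (\<forall>i\<in>{1..s}. \<forall>j\<in>{1..s}. b i * b j - b i * A i j - b j * A j i = 0)"

section \<open>The method on one cell\<close>

text \<open>
  Stage quantities take the spatial stage \<open>i\<close> first and the temporal stage \<open>m\<close> second.
  The fields \<open>_left\<close>, \<open>_right\<close> live at \<open>x = 0, \<Delta>x\<close> and are indexed by \<open>m\<close> (written
  \<open>u\<^sub>0\<^sup>m\<close>, \<open>u\<^sub>1\<^sup>m\<close>); the fields \<open>_old\<close>, \<open>_new\<close> live at \<open>t = 0, \<Delta>t\<close> and are indexed by \<open>i\<close>
  (written \<open>u\<^sub>i\<^sup>0\<close>, \<open>u\<^sub>i\<^sup>1\<close>).  A \<open>bar\<close> marks the overlined quantities, and \<open>DW\<close> is \<open>\<delta>\<^sub>x W\<close>.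
\<close>

record rk_cell =
  stU :: "nat \<Rightarrow> nat \<Rightarrow> real"
  stV :: "nat \<Rightarrow> nat \<Rightarrow> real"
  stW :: "nat \<Rightarrow> nat \<Rightarrow> real"
  stDW :: "nat \<Rightarrow> nat \<Rightarrow> real"
  u_left :: "nat \<Rightarrow> real"
  u_right :: "nat \<Rightarrow> real"
  ubar_right :: "nat \<Rightarrow> real"
  w_left :: "nat \<Rightarrow> real"
  w_right :: "nat \<Rightarrow> real"
  wbar_right :: "nat \<Rightarrow> real"
  u_old :: "nat \<Rightarrow> real"
  u_new :: "nat \<Rightarrow> real"
  ubar_new :: "nat \<Rightarrow> real"
  v_old :: "nat \<Rightarrow> real"
  v_new :: "nat \<Rightarrow> real"
  vbar_new :: "nat \<Rightarrow> real"

definition rk_space_equations ::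
    "nat \<Rightarrow> nat \<Rightarrow> (nat \<Rightarrow> nat \<Rightarrow> real) \<Rightarrow> (nat \<Rightarrow> real) \<Rightarrow> real \<Rightarrow> rk_cell \<Rightarrow> bool" where
  "rk_space_equations s r A b \<Delta>x z \<longleftrightarrow>
     (\<forall>i\<in>{1..s}. \<forall>m\<in>{1..r}.
        stU z i m = u_left z m + \<Delta>x * (\<Sum>j=1..s. A i j * stW z j m) \<and>
        stW z i m = w_left z m + \<Delta>x * (\<Sum>j=1..s. A i j * stDW z j m)) \<and>
     (\<forall>m\<in>{1..r}.
        ubar_right z m = u_left z m + \<Delta>x * (\<Sum>i=1..s. b i * stW z i m) \<and>
        wbar_right z m = w_left z m + \<Delta>x * (\<Sum>i=1..s. b i * stDW z i m))"

definition rk_time_equations ::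
    "nat \<Rightarrow> nat \<Rightarrow> (nat \<Rightarrow> nat \<Rightarrow> real) \<Rightarrow> (nat \<Rightarrow> real) \<Rightarrow> real \<Rightarrow> (real \<Rightarrow> real) \<Rightarrow>
     rk_cell \<Rightarrow> bool" where
  "rk_time_equations s r A' b' \<Delta>t f z \<longleftrightarrow>
     (\<forall>i\<in>{1..s}. \<forall>m\<in>{1..r}.
        stU z i m = u_old z i + \<Delta>t * (\<Sum>n=1..r. A' m n * stV z i n) \<and>
        stV z i m = v_old z i + \<Delta>t * (\<Sum>n=1..r. A' m n * (stDW z i n - f (stU z i n)))) \<and>
     (\<forall>i\<in>{1..s}.
        ubar_new z i = u_old z i + \<Delta>t * (\<Sum>m=1..r. b' m * stV z i m) \<and>
        vbar_new z i = v_old z i + \<Delta>t * (\<Sum>m=1..r. b' m * (stDW z i m - f (stU z i m))))"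

definition stochastic_update ::
    "nat \<Rightarrow> nat \<Rightarrow> (real \<Rightarrow> real) \<Rightarrow> (nat \<Rightarrow> real) \<Rightarrow> rk_cell \<Rightarrow> bool" where
  "stochastic_update s r g \<Delta>W z \<longleftrightarrow>
     (\<forall>m\<in>{1..r}. u_right z m = ubar_right z m \<and> w_right z m = wbar_right z m) \<and>
     (\<forall>i\<in>{1..s}. u_new z i = ubar_new z i \<and>
        v_new z i = vbar_new z i + g (ubar_new z i) * \<Delta>W i)"

definition splitting_rk_method ::
    "nat \<Rightarrow> nat \<Rightarrow> (nat \<Rightarrow> nat \<Rightarrow> real) \<Rightarrow> (nat \<Rightarrow> real) \<Rightarrow> (nat \<Rightarrow> nat \<Rightarrow> real) \<Rightarrow> (nat \<Rightarrow> real) \<Rightarrow>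
     real \<Rightarrow> real \<Rightarrow> (real \<Rightarrow> real) \<Rightarrow> (real \<Rightarrow> real) \<Rightarrow> (nat \<Rightarrow> real) \<Rightarrow> rk_cell \<Rightarrow> bool" where
  "splitting_rk_method s r A b A' b' \<Delta>x \<Delta>t f g \<Delta>W z \<longleftrightarrow>
     rk_space_equations s r A b \<Delta>x z \<and>
     rk_time_equations s r A' b' \<Delta>t f z \<and>
     stochastic_update s r g \<Delta>W z"

text \<open>\<open>W t x\<close> is one realization of the noise.\<close>

definition noise_increment ::
    "nat \<Rightarrow> (nat \<Rightarrow> nat \<Rightarrow> real) \<Rightarrow> real \<Rightarrow> real \<Rightarrow> (real \<Rightarrow> real \<Rightarrow> real) \<Rightarrow> nat \<Rightarrow> real" where
  "noise_increment s A \<Delta>x \<Delta>t W i =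
     (let c = (\<Sum>j=1..s. A i j) in W \<Delta>t (c * \<Delta>x) - W 0 (c * \<Delta>x))"

section \<open>Differential forms on the parameter space\<close>

definition differential :: "('p::real_normed_vector \<Rightarrow> real) \<Rightarrow> 'p \<Rightarrow> 'p \<Rightarrow> real" where
  "differential h p = frechet_derivative h (at p)"

definition wedge :: "('p \<Rightarrow> real) \<Rightarrow> ('p \<Rightarrow> real) \<Rightarrow> 'p \<Rightarrow> 'p \<Rightarrow> real" where
  "wedge \<alpha> \<beta> \<xi> \<eta> = \<alpha> \<xi> * \<beta> \<eta> - \<alpha> \<eta> * \<beta> \<xi>"

definition cell_differentiable ::
    "nat \<Rightarrow> nat \<Rightarrow> ('p::real_normed_vector \<Rightarrow> rk_cell) \<Rightarrow> 'p \<Rightarrow> bool" where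
  "cell_differentiable s r z p \<longleftrightarrow>
     (\<forall>q\<in>{stU, stV, stW, stDW}. \<forall>i\<in>{1..s}. \<forall>m\<in>{1..r}.
        (\<lambda>p. q (z p) i m) differentiable (at p)) \<and>
     (\<forall>q\<in>{u_left, u_right, ubar_right, w_left, w_right, wbar_right}. \<forall>m\<in>{1..r}.
        (\<lambda>p. q (z p) m) differentiable (at p)) \<and>
     (\<forall>q\<in>{u_old, u_new, ubar_new, v_old, v_new, vbar_new}. \<forall>i\<in>{1..s}.
        (\<lambda>p. q (z p) i) differentiable (at p))"

end

theory Submission
  imports Defs
begin

text \<open>
  A symplectic Runge--Kutta step satisfies the exact Leibniz rule for quadratic forms: the
  increment of \<open>x \<and> y\<close> over the step is \<open>h \<Sum> b\<^sub>i (X\<^sub>i \<and> L\<^sub>i + K\<^sub>i \<and> Y\<^sub>i)\<close>, with stages \<open>X\<^sub>i, Y\<^sub>i\<close> and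
  slopes \<open>K\<^sub>i, L\<^sub>i\<close>.  For the linearized scheme, the increments of \<open>du \<and> dv\<close> in time and of
  \<open>du \<and> dw\<close> in space are both weighted sums of the same forms \<open>dU\<^sub>i\<^sup>m \<and> d(\<delta>\<^sub>x W\<^sub>i\<^sup>m)\<close>, because
  \<open>dV \<and> dV\<close>, \<open>dW \<and> dW\<close> and \<open>dU \<and> f'(U) dU\<close> vanish.  The symplectic Euler update adds to \<open>dv\<close> a
  multiple of \<open>du\<close>, so it does not change \<open>du \<and> dv\<close>.
\<close>

section \<open>Products and wedges along a symplectic Runge-Kutta step\<close>

text \<open>Expanding \<open>x1 * y1\<close>, the terms linear in \<open>h\<close> are those of the
  right-hand side with \<open>x0\<close>, \<open>y0\<close> in place of the stages. The symplectic
  condition splits the term in \<open>h\<close> squared into exactly the missing corrections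
  \<open>X i - x0\<close> and \<open>Y i - y0\<close>. The scalar form lets the two factors be
  values of forms at different vectors.\<close>

lemma symplectic_rk_bilinear:
  fixes X Y K L :: "nat \<Rightarrow> real" and x0 x1 y0 y1 h :: real
  assumes symp: "symplectic_condition s A b"
    and X: "\<And>i. i \<in> {1..s} \<Longrightarrow> X i = x0 + h * (\<Sum>j=1..s. A i j * K j)"
    and Y: "\<And>i. i \<in> {1..s} \<Longrightarrow> Y i = y0 + h * (\<Sum>j=1..s. A i j * L j)"
    and x1: "x1 = x0 + h * (\<Sum>i=1..s. b i * K i)"
    and y1: "y1 = y0 + h * (\<Sum>i=1..s. b i * L i)"
  shows "x1 * y1 - x0 * y0 = h * (\<Sum>i=1..s. b i * (X i * L i + K i * Y i))"
proof -
  have "(\<Sum>i=1..s. b i * K i) * (\<Sum>j=1..s. b j * L j)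
      = (\<Sum>i=1..s. \<Sum>j=1..s. (b i * b j) * (K i * L j))"
    by (simp add: sum_product mult_ac)
  also have "\<dots> = (\<Sum>i=1..s. \<Sum>j=1..s. (b i * A i j + b j * A j i) * (K i * L j))"
  proof (intro sum.cong refl)
    fix i j assume "i \<in> {1..s}" "j \<in> {1..s}"
    then have "b i * b j = b i * A i j + b j * A j i"
      using symp unfolding symplectic_condition_def by fastforce
    then show "(b i * b j) * (K i * L j) = (b i * A i j + b j * A j i) * (K i * L j)"
      by simp
  qed
  also have "\<dots> = (\<Sum>i=1..s. \<Sum>j=1..s. b i * A i j * (K i * L j))
      + (\<Sum>i=1..s. \<Sum>j=1..s. b j * A j i * (K i * L j))"
    by (simp add: distrib_right sum.distrib)
  \<comment> \<open>After the swap both halves carry \<open>b i * A i j\<close>, so their inner sums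
    are the stage increments of \<open>Y i\<close> and \<open>X i\<close> up to the factor
    \<open>h\<close>.\<close>
  also have "(\<Sum>i=1..s. \<Sum>j=1..s. b j * A j i * (K i * L j))
      = (\<Sum>i=1..s. \<Sum>j=1..s. b i * A i j * (K j * L i))"
    by (rule sum.swap)
  finally have product: "(\<Sum>i=1..s. b i * K i) * (\<Sum>j=1..s. b j * L j)
      = (\<Sum>i=1..s. b i * (K i * (\<Sum>j=1..s. A i j * L j)))
      + (\<Sum>i=1..s. b i * ((\<Sum>j=1..s. A i j * K j) * L i))"
    by (simp add: sum_distrib_left sum_distrib_right mult_ac)
  have "(\<Sum>i=1..s. b i * (X i * L i + K i * Y i))
      = (\<Sum>i=1..s. x0 * (b i * L i) + y0 * (b i * K i)
          + h * (b i * (K i * (\<Sum>j=1..s. A i j * L j)))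
          + h * (b i * ((\<Sum>j=1..s. A i j * K j) * L i)))"
    by (intro sum.cong refl, simp only: X Y) (simp add: algebra_simps)
  also have "\<dots> = x0 * (\<Sum>i=1..s. b i * L i) + y0 * (\<Sum>i=1..s. b i * K i)
      + h * ((\<Sum>i=1..s. b i * K i) * (\<Sum>j=1..s. b j * L j))"
    unfolding product
    by (simp add: sum.distrib sum_distrib_left sum_distrib_right distrib_left mult_ac)
  finally show ?thesis
    unfolding x1 y1 by (simp add: algebra_simps)
qed

text \<open>A wedge antisymmetrizes a product of values at two vectors, so the scalar identity is
  taken at \<open>(\<xi>, \<eta>)\<close> and at \<open>(\<eta>, \<xi>)\<close> and
  subtracted.\<close>

lemma symplectic_rk_wedge:
  fixes X Y K L :: "nat \<Rightarrow> 'p \<Rightarrow> real" and x0 x1 y0 y1 :: "'p \<Rightarrow> real"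
  assumes symp: "symplectic_condition s A b"
    and X: "\<And>i v. i \<in> {1..s} \<Longrightarrow> X i v = x0 v + h * (\<Sum>j=1..s. A i j * K j v)"
    and Y: "\<And>i v. i \<in> {1..s} \<Longrightarrow> Y i v = y0 v + h * (\<Sum>j=1..s. A i j * L j v)"
    and x1: "\<And>v. x1 v = x0 v + h * (\<Sum>i=1..s. b i * K i v)"
    and y1: "\<And>v. y1 v = y0 v + h * (\<Sum>i=1..s. b i * L i v)"
  shows "wedge x1 y1 \<xi> \<eta> - wedge x0 y0 \<xi> \<eta>
       = h * (\<Sum>i=1..s. b i * (wedge (X i) (L i) \<xi> \<eta> + wedge (K i) (Y i) \<xi> \<eta>))"
proof -
  have bilinear: "x1 v * y1 v' - x0 v * y0 v'
      = h * (\<Sum>i=1..s. b i * (X i v * L i v' + K i v * Y i v'))" for v v'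
    by (rule symplectic_rk_bilinear[OF symp X Y x1 y1])
  have "wedge x1 y1 \<xi> \<eta> - wedge x0 y0 \<xi> \<eta>
      = h * (\<Sum>i=1..s. b i * (X i \<xi> * L i \<eta> + K i \<xi> * Y i \<eta>))
      - h * (\<Sum>i=1..s. b i * (X i \<eta> * L i \<xi> + K i \<eta> * Y i \<xi>))"
    unfolding wedge_def bilinear[symmetric] by simp
  also have "\<dots> = h * (\<Sum>i=1..s. b i * (wedge (X i) (L i) \<xi> \<eta> + wedge (K i) (Y i) \<xi> \<eta>))"
    unfolding wedge_def right_diff_distrib[symmetric] sum_subtractf[symmetric]
    by (simp add: algebra_simps)
  finally show ?thesis .
qed

lemma wedge_self: "wedge \<alpha> \<alpha> \<xi> \<eta> = 0"
  by (simp add: wedge_def)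

lemma wedge_add_multiple: "wedge \<alpha> (\<lambda>v. \<beta> v + c * \<alpha> v) \<xi> \<eta> = wedge \<alpha> \<beta> \<xi> \<eta>"
  by (simp add: wedge_def algebra_simps)

section \<open>Differentiating the scheme with respect to the parameter\<close>

lemma has_derivative_differential:
  "h differentiable (at p) \<Longrightarrow> (h has_derivative differential h p) (at p)"
  unfolding differential_def by (simp add: frechet_derivative_works)

text \<open>The scheme is known only for parameters in \<open>P\<close>; openness makes its
  equations hold near \<open>p\<close>, which suffices to differentiate them there.\<close>

lemma differential_eqI:
  assumes "open P" "p \<in> P" "\<And>q. q \<in> P \<Longrightarrow> h q = k q" "(k has_derivative k') (at p)"
  shows "differential h p = k'"
proof -
  have "(h has_derivative k') (at p)"
    using assms(4,1,2) by (rule has_derivative_transform_within_open) (simp add: assms(3))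
  then show ?thesis
    unfolding differential_def by (rule frechet_derivative_at[symmetric])
qed

text \<open>Source of the linearized scheme: stage and end-point equations share this shape. The
  derivatives \<open>k'\<close> are left free so that the slope of \<open>v\<close> can enter in its
  chain-rule form.\<close>

lemma differential_rk:
  assumes "open P" "p \<in> P"
    and "\<And>q. q \<in> P \<Longrightarrow> h q = c q + \<tau> * (\<Sum>j\<in>J. a j * k j q)"
    and "c differentiable (at p)"
    and "\<And>j. j \<in> J \<Longrightarrow> (k j has_derivative k' j) (at p)"
  shows "differential h p v = differential c p v + \<tau> * (\<Sum>j\<in>J. a j * k' j v)"
proof -
  have "differential h p = (\<lambda>v. differential c p v + \<tau> * (\<Sum>j\<in>J. a j * k' j v))"
    by (rule differential_eqI[OF assms(1,2)], erule assms(3))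
      (intro has_derivative_add has_derivative_mult_right has_derivative_sum
         has_derivative_differential assms(4,5))
  then show ?thesis by simp
qed

lemma has_derivative_real_chain:
  fixes f :: "real \<Rightarrow> real"
  assumes "f differentiable (at (h p))" "h differentiable (at p)"
  shows "((\<lambda>q. f (h q)) has_derivative (\<lambda>v. deriv f (h p) * differential h p v)) (at p)"
proof -
  have "(f has_real_derivative deriv f (h p)) (at (h p))"
    using assms(1) by (simp add: DERIV_deriv_iff_real_differentiable)
  then show ?thesis
    using has_derivative_differential[OF assms(2)]
    by (rule DERIV_compose_FDERIV[THEN has_derivative_eq_rhs]) (simp add: mult.commute)
qed

text \<open>The instance \<open>n = 1\<close> of smoothness, which gives differentiability of
  \<open>f\<close> and \<open>g\<close> from that of their potentials.\<close>

lemma smooth_fun_deriv_differentiable: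
  "smooth_fun h \<Longrightarrow> deriv h differentiable (at x)"
  unfolding smooth_fun_def by (metis funpow_0 funpow_simps_right(2) o_apply One_nat_def)

section \<open>Increments of the two forms across one cell\<close>

lemma space_increment_wedge:
  assumes P: "open P" "p \<in> P"
    and scheme: "\<And>q. q \<in> P \<Longrightarrow> rk_space_equations s r A b \<Delta>x (z q)"
      "\<And>q. q \<in> P \<Longrightarrow> stochastic_update s r g \<Delta>W (z q)"
    and diff: "cell_differentiable s r z p"
    and symp: "symplectic_condition s A b"
    and m: "m \<in> {1..r}"
  shows "wedge (differential (\<lambda>p. u_right (z p) m) p) (differential (\<lambda>p. w_right (z p) m) p) \<xi> \<eta>
       - wedge (differential (\<lambda>p. u_left (z p) m) p) (differential (\<lambda>p. w_left (z p) m) p) \<xi> \<eta>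
       = \<Delta>x * (\<Sum>i=1..s. b i * wedge (differential (\<lambda>p. stU (z p) i m) p)
                                      (differential (\<lambda>p. stDW (z p) i m) p) \<xi> \<eta>)"
proof -
  have d: "(\<lambda>p. u_left (z p) m) differentiable (at p)" "(\<lambda>p. w_left (z p) m) differentiable (at p)"
    using diff m unfolding cell_differentiable_def by auto
  have dW: "((\<lambda>p. stW (z p) i m) has_derivative differential (\<lambda>p. stW (z p) i m) p) (at p)"
    and dDW: "((\<lambda>p. stDW (z p) i m) has_derivative differential (\<lambda>p. stDW (z p) i m) p) (at p)"
    if "i \<in> {1..s}" for i
    using diff m that unfolding cell_differentiable_def
    by (auto intro: has_derivative_differential)
  show ?thesis
    \<comment> \<open>In space \<open>stW\<close> is both the slope of \<open>u\<close> and the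
      stage of \<open>w\<close>: \<open>K\<close> and \<open>Y\<close> coincide and their wedge
      vanishes.\<close>
    by (subst symplectic_rk_wedge[OF symp,
          where X = "\<lambda>i. differential (\<lambda>p. stU (z p) i m) p"
            and Y = "\<lambda>i. differential (\<lambda>p. stW (z p) i m) p"
            and K = "\<lambda>i. differential (\<lambda>p. stW (z p) i m) p"
            and L = "\<lambda>i. differential (\<lambda>p. stDW (z p) i m) p"];
        (rule differential_rk[OF P _ _ dW] differential_rk[OF P _ _ dDW])?)
      (use scheme m in \<open>auto simp: rk_space_equations_def stochastic_update_def wedge_self d\<close>)
qed

text \<open>Neither \<open>f\<close> nor \<open>g\<close> leaves a trace: each contributes to the
  differential of its equation only a multiple of the form it is wedged with. What remains are the
  same forms as in the space increment.\<close>

lemma time_increment_wedge: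
  assumes P: "open P" "p \<in> P"
    and scheme: "\<And>q. q \<in> P \<Longrightarrow> rk_time_equations s r A b \<Delta>t f (z q)"
      "\<And>q. q \<in> P \<Longrightarrow> stochastic_update s r g \<Delta>W (z q)"
    and diff: "cell_differentiable s r z p"
    and f: "\<And>x. f differentiable (at x)" and g: "\<And>x. g differentiable (at x)"
    and symp: "symplectic_condition r A b"
    and i: "i \<in> {1..s}"
  shows "wedge (differential (\<lambda>p. u_new (z p) i) p) (differential (\<lambda>p. v_new (z p) i) p) \<xi> \<eta>
       - wedge (differential (\<lambda>p. u_old (z p) i) p) (differential (\<lambda>p. v_old (z p) i) p) \<xi> \<eta>
       = \<Delta>t * (\<Sum>m=1..r. b m * wedge (differential (\<lambda>p. stU (z p) i m) p)
                                      (differential (\<lambda>p. stDW (z p) i m) p) \<xi> \<eta>)"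
proof -
  have d: "(\<lambda>p. u_old (z p) i) differentiable (at p)" "(\<lambda>p. v_old (z p) i) differentiable (at p)"
      "(\<lambda>p. ubar_new (z p) i) differentiable (at p)" "(\<lambda>p. vbar_new (z p) i) differentiable (at p)"
    using diff i unfolding cell_differentiable_def by auto
  have dV: "((\<lambda>p. stV (z p) i m) has_derivative differential (\<lambda>p. stV (z p) i m) p) (at p)"
    if "m \<in> {1..r}" for m
    using diff i that unfolding cell_differentiable_def
    by (auto intro: has_derivative_differential)
  \<comment> \<open>The differential of the slope of \<open>v\<close> at stage
    \<open>(i, m)\<close>. Its second term is a multiple of the differential of \<open>stU\<close>,
    which is why \<open>wedge_F\<close> can discard it.\<close>
  define F where "F m v = differential (\<lambda>p. stDW (z p) i m) p v
      - deriv f (stU (z p) i m) * differential (\<lambda>p. stU (z p) i m) p v" for m v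
  have dF: "((\<lambda>p. stDW (z p) i m - f (stU (z p) i m)) has_derivative F m) (at p)"
    if "m \<in> {1..r}" for m
    unfolding F_def using diff i that unfolding cell_differentiable_def
    by (intro has_derivative_diff has_derivative_differential has_derivative_real_chain f) auto
  have wedge_F: "wedge (differential (\<lambda>p. stU (z p) i m) p) (F m) \<xi> \<eta>
      = wedge (differential (\<lambda>p. stU (z p) i m) p) (differential (\<lambda>p. stDW (z p) i m) p) \<xi> \<eta>" for m
    by (simp add: F_def wedge_def algebra_simps)
  have u_new: "differential (\<lambda>p. u_new (z p) i) p = differential (\<lambda>p. ubar_new (z p) i) p"
    by (rule differential_eqI[OF P _ has_derivative_differential])
      (use scheme i in \<open>auto simp: stochastic_update_def d\<close>)
  \<comment> \<open>The increment \<open>\<Delta>W i\<close> does not depend on the parameter and is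
    differentiated as a constant factor. The result has the shape of
    \<open>wedge_add_multiple\<close>, once \<open>u_new\<close> is replaced by
    \<open>ubar_new\<close>.\<close>
  have v_new: "differential (\<lambda>p. v_new (z p) i) p = (\<lambda>v. differential (\<lambda>p. vbar_new (z p) i) p v
      + (deriv g (ubar_new (z p) i) * \<Delta>W i) * differential (\<lambda>p. ubar_new (z p) i) p v)"
  proof (rule differential_eqI[OF P])
    show "v_new (z q) i = vbar_new (z q) i + g (ubar_new (z q) i) * \<Delta>W i" if "q \<in> P" for q
      using scheme(2)[OF that] i by (auto simp: stochastic_update_def)
    show "((\<lambda>q. vbar_new (z q) i + g (ubar_new (z q) i) * \<Delta>W i) has_derivative
        (\<lambda>v. differential (\<lambda>p. vbar_new (z p) i) p v
          + (deriv g (ubar_new (z p) i) * \<Delta>W i) * differential (\<lambda>p. ubar_new (z p) i) p v)) (at p)"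
      by (rule has_derivative_eq_rhs[OF has_derivative_add[OF has_derivative_differential[OF d(4)]
            has_derivative_mult_left[OF has_derivative_real_chain[OF g d(3)]]]])
        (simp add: mult_ac)
  qed
  show ?thesis
    unfolding u_new v_new wedge_add_multiple
    \<comment> \<open>In time the coinciding pair is \<open>stV\<close>, the slope of
      \<open>u\<close> and the stage of \<open>v\<close>.\<close>
    by (subst symplectic_rk_wedge[OF symp,
          where X = "\<lambda>m. differential (\<lambda>p. stU (z p) i m) p"
            and Y = "\<lambda>m. differential (\<lambda>p. stV (z p) i m) p"
            and K = "\<lambda>m. differential (\<lambda>p. stV (z p) i m) p"
            and L = F];
        (rule differential_rk[OF P _ _ dV] differential_rk[OF P _ _ dF])?)
      (use scheme i in \<open>auto simp: rk_time_equations_def wedge_self wedge_F d\<close>)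
qed

section \<open>Summation over the cell\<close>

text \<open>For fixed \<open>\<omega>\<close> the numerical solution is a family
  \<open>z \<omega>\<close> over an open parameter set, and the exterior derivative acts on the
  parameter alone. Quantifying over \<open>\<xi>\<close> and \<open>\<eta>\<close> makes the law an
  identity of 2-forms.\<close>

theorem theorem4p1:
  fixes s r :: nat
    and A :: "nat \<Rightarrow> nat \<Rightarrow> real" and b :: "nat \<Rightarrow> real"
    and A' :: "nat \<Rightarrow> nat \<Rightarrow> real" and b' :: "nat \<Rightarrow> real"
    and \<Delta>x \<Delta>t :: real
    and f_pot g_pot f g :: "real \<Rightarrow> real"
    and M :: "'w measure" and D :: "real set"
    and Q :: "(real \<Rightarrow> real) \<Rightarrow> (real \<Rightarrow> real)"
    and W :: "real \<Rightarrow> 'w \<Rightarrow> real \<Rightarrow> real"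
    and P :: "'p::real_normed_vector set"
    and z :: "'w \<Rightarrow> 'p \<Rightarrow> rk_cell"
  assumes "s \<ge> 1" and "r \<ge> 1" and "\<Delta>x > 0" and "\<Delta>t > 0"
    and "smooth_fun f_pot" and "smooth_fun g_pot"
    and "f = deriv f_pot" and "g = deriv g_pot"
    and "globally_lipschitz f" and "globally_lipschitz g"
    and "D \<in> sets borel"
    and "Q_Wiener_process M (restrict_space lborel D) Q W"
    and "symplectic_condition s A b" and "symplectic_condition r A' b'"
    and "open P"
    and "AE \<omega> in M. \<forall>p\<in>P.
           splitting_rk_method s r A b A' b' \<Delta>x \<Delta>t f g
             (noise_increment s A \<Delta>x \<Delta>t (\<lambda>t. W t \<omega>)) (z \<omega> p)"
    and "AE \<omega> in M. \<forall>p\<in>P. cell_differentiable s r (z \<omega>) p"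
  shows "AE \<omega> in M. \<forall>p\<in>P. \<forall>\<xi> \<eta>.
           (\<Sum>i=1..s. b i / \<Delta>t *
              (wedge (differential (\<lambda>p. u_new (z \<omega> p) i) p)
                     (differential (\<lambda>p. v_new (z \<omega> p) i) p) \<xi> \<eta>
             - wedge (differential (\<lambda>p. u_old (z \<omega> p) i) p)
                     (differential (\<lambda>p. v_old (z \<omega> p) i) p) \<xi> \<eta>))
         - (\<Sum>m=1..r. b' m / \<Delta>x *
              (wedge (differential (\<lambda>p. u_right (z \<omega> p) m) p)
                     (differential (\<lambda>p. w_right (z \<omega> p) m) p) \<xi> \<eta>
             - wedge (differential (\<lambda>p. u_left (z \<omega> p) m) p)
                     (differential (\<lambda>p. w_left (z \<omega> p) m) p) \<xi> \<eta>)) = 0"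
proof -
  have f: "f differentiable (at x)" and g: "g differentiable (at x)" for x
    using assms(5-8) by (simp_all add: smooth_fun_deriv_differentiable)
  show ?thesis
    \<comment> \<open>The argument is pathwise on the almost sure event where both assumptions on
      \<open>z\<close> hold.\<close>
    using assms(16,17)
  proof eventually_elim
    case (elim \<omega>)
    show ?case
    proof (intro ballI allI)
      fix p \<xi> \<eta> assume p: "p \<in> P"
      let ?\<Omega> = "\<lambda>i m. wedge (differential (\<lambda>p. stU (z \<omega> p) i m) p)
                            (differential (\<lambda>p. stDW (z \<omega> p) i m) p) \<xi> \<eta>"
      have scheme: "rk_space_equations s r A b \<Delta>x (z \<omega> q)"
          "rk_time_equations s r A' b' \<Delta>t f (z \<omega> q)"
          "stochastic_update s r g (noise_increment s A \<Delta>x \<Delta>t (\<lambda>t. W t \<omega>)) (z \<omega> q)"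
        if "q \<in> P" for q
        using elim(1) that unfolding splitting_rk_method_def by auto
      have diff: "cell_differentiable s r (z \<omega>) p"
        using elim(2) p by blast
      \<comment> \<open>A time increment supplies the weights \<open>b' m\<close> and the factor
        \<open>\<Delta>t\<close>, a space increment below the weights \<open>b i\<close> and the
        factor \<open>\<Delta>x\<close>. With the outer weights, both sides become the double sum of
        \<open>b i * b' m * ?\<Omega> i m\<close>, differing only in the order of summation.\<close>
      have "(\<Sum>i=1..s. b i / \<Delta>t *
              (wedge (differential (\<lambda>p. u_new (z \<omega> p) i) p)
                     (differential (\<lambda>p. v_new (z \<omega> p) i) p) \<xi> \<eta>
             - wedge (differential (\<lambda>p. u_old (z \<omega> p) i) p)
                     (differential (\<lambda>p. v_old (z \<omega> p) i) p) \<xi> \<eta>))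
          = (\<Sum>i=1..s. \<Sum>m=1..r. b i * b' m * ?\<Omega> i m)"
        using \<open>\<Delta>t > 0\<close>
        by (intro sum.cong refl, subst time_increment_wedge[OF \<open>open P\<close> p scheme(2,3) diff f g assms(14)])
          (auto simp: sum_distrib_left mult_ac)
      moreover have "(\<Sum>m=1..r. b' m / \<Delta>x *
              (wedge (differential (\<lambda>p. u_right (z \<omega> p) m) p)
                     (differential (\<lambda>p. w_right (z \<omega> p) m) p) \<xi> \<eta>
             - wedge (differential (\<lambda>p. u_left (z \<omega> p) m) p)
                     (differential (\<lambda>p. w_left (z \<omega> p) m) p) \<xi> \<eta>))
          = (\<Sum>m=1..r. \<Sum>i=1..s. b i * b' m * ?\<Omega> i m)"
        using \<open>\<Delta>x > 0\<close>
        by (intro sum.cong refl, subst space_increment_wedge[OF \<open>open P\<close> p scheme(1,3) diff assms(13)])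
          (auto simp: sum_distrib_left mult_ac)
      ultimately show "(\<Sum>i=1..s. b i / \<Delta>t *
              (wedge (differential (\<lambda>p. u_new (z \<omega> p) i) p)
                     (differential (\<lambda>p. v_new (z \<omega> p) i) p) \<xi> \<eta>
             - wedge (differential (\<lambda>p. u_old (z \<omega> p) i) p)
                     (differential (\<lambda>p. v_old (z \<omega> p) i) p) \<xi> \<eta>))
         - (\<Sum>m=1..r. b' m / \<Delta>x *
              (wedge (differential (\<lambda>p. u_right (z \<omega> p) m) p)
                     (differential (\<lambda>p. w_right (z \<omega> p) m) p) \<xi> \<eta>
             - wedge (differential (\<lambda>p. u_left (z \<omega> p) m) p)
                     (differential (\<lambda>p. w_left (z \<omega> p) m) p) \<xi> \<eta>)) = 0"
        using sum.swap[of "\<lambda>i m. b i * b' m * ?\<Omega> i m" "{1..r}" "{1..s}"] by simp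
    qed
  qed
qed

end
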